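(* Let $n$ be a positive integer and let $\mathcal{F}$ be any family of subsets of $\mathbb{R}^n$ that contains all compact subsets of $\mathbb{R}^n$. Let $D\colon\mathcal{F}\to[0,n]$ be such that (1) $D(f(K))\le D(K)$ for any compact set $K\subset\mathbb{R}^n$ and any Lipschitz map $f\colon K\to\mathbb{R}^n$ for which $f^{-1}$ is Lipschitz decomposable, (2) $D$ is monotone: $D(A)\le D(B)$ whenever $A,B\in\mathcal{F}$ and $A\subset B$, (3) $D(S)$ equals the similarity dimension of $S$ for every homogeneous self-similar set $S\subset\mathbb{R}^n$ with the strong separation condition. Then for every bounded $K\in\mathcal{F}$ we have $D(K)\le\dim_A K$.
   Context: Lipschitz decomposability: let $(X,d_X)$, $(Y,d_Y)$ be metric spaces and $\mathcal{R}\subset X\times Y$ a relation. Its domain is $\operatorname{dom}\mathcal{R}=\{x\in X:\exists y\in Y,\ (x,y)\in\mathcal{R}\}$ and the image of $A\subset X$ is $\mathcal{R}(A)=\{y\in Y:\exists x\in A,\ (x,y)\in\mathcal{R}\}$. $\mathcal{R}$ is Lipschitz decomposable if $\operatorname{dom}\mathcal{R}=X$ and there are $M\in\mathbb{N}$ and $c>0$ such that for all $x\in X$ and $r>0$ there are $y_1,\dots,y_M\in Y$ with $\mathcal{R}(B_X(x,r))\subset\bigcup_{i=1}^M B_Y(y_i,cr)$, where $B$ denotes closed balls. For a map $f\colon K\to\mathbb{R}^n$, $f^{-1}$ denotes the relation $\{(y,x): f(x)=y\}\subset f(K)\times K$. A self-similar set is a nonempty compact $S\subset\mathbb{R}^n$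 with $S=\bigcup_{i=1}^m f_i(S)$ for finitely many contracting similarities $f_i$ with ratios $r_i$; its similarity dimension is the unique $s$ with $\sum_i r_i^s=1$; it is homogeneous if $r_1=\dots=r_m$; the strong separation condition means $f_i(S)\cap f_j(S)=\emptyset$ for $i\ne j$. Assouad dimension of $X\subset\mathbb{R}^n$: $\dim_A X$ is the infimum of those $\alpha\ge0$ for which there is $C>0$ such that $N(B(x,R)\cap X,r)\le C(R/r)^\alpha$ for all $0<r<R$ and all $x\in X$, where $N(Z,r)$ is the minimal number of closed balls of radius $r$ that cover $Z$. *)

theory Defs
  imports "HOL-Analysis.Analysis"
begin

text \<open>
  Metric spaces \<open>X\<close>, \<open>Y\<close> are given as subsets of ambient metric types, with the induced metric, so
  the closed ball \<open>B\<^sub>X(x,r)\<close> of \<open>X\<close> is \<open>cball x r \<inter> X\<close>, and balls of \<open>Y\<close> have their centres in \<open>Y\<close>.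
\<close>

definition lipschitz_decomposable ::
  "'a::metric_space set \<Rightarrow> 'b::metric_space set \<Rightarrow> ('a \<times> 'b) set \<Rightarrow> bool" where
  "lipschitz_decomposable X Y R \<longleftrightarrow>
     R \<subseteq> X \<times> Y \<and> Domain R = X \<and>
     (\<exists>(M::nat) (c::real). c > 0 \<and>
        (\<forall>x\<in>X. \<forall>r>0. \<exists>y::nat \<Rightarrow> 'b. (\<forall>i\<in>{1..M}. y i \<in> Y) \<and>
           R `` (cball x r \<inter> X) \<subseteq> (\<Union>i\<in>{1..M}. cball (y i) (c * r) \<inter> Y)))"

definition inverse_relation :: "'a set \<Rightarrow> ('a \<Rightarrow> 'b) \<Rightarrow> ('b \<times> 'a) set" where
  "inverse_relation K f = {(y, x). x \<in> K \<and> f x = y}"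

definition contracting_similarity :: "real \<Rightarrow> ('a::metric_space \<Rightarrow> 'a) \<Rightarrow> bool" where
  "contracting_similarity r f \<longleftrightarrow>
     0 < r \<and> r < 1 \<and> (\<forall>x y. dist (f x) (f y) = r * dist x y)"

definition self_similar_set ::
  "nat \<Rightarrow> (nat \<Rightarrow> 'a::metric_space \<Rightarrow> 'a) \<Rightarrow> (nat \<Rightarrow> real) \<Rightarrow> 'a set \<Rightarrow> bool" where
  "self_similar_set m f r S \<longleftrightarrow>
     S \<noteq> {} \<and> compact S \<and>
     (\<forall>i\<in>{1..m}. contracting_similarity (r i) (f i)) \<and>
     S = (\<Union>i\<in>{1..m}. f i ` S)"

definition homogeneous :: "nat \<Rightarrow> (nat \<Rightarrow> real) \<Rightarrow> bool" where
  "homogeneous m r \<longleftrightarrow> (\<forall>i\<in>{1..m}. \<forall>j\<in>{1..m}. r i = r j)"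

definition strong_separation :: "nat \<Rightarrow> (nat \<Rightarrow> 'a \<Rightarrow> 'a) \<Rightarrow> 'a set \<Rightarrow> bool" where
  "strong_separation m f S \<longleftrightarrow>
     (\<forall>i\<in>{1..m}. \<forall>j\<in>{1..m}. i \<noteq> j \<longrightarrow> f i ` S \<inter> f j ` S = {})"

text \<open>
  Existence and uniqueness hold whenever \<open>m \<ge> 1\<close> and all ratios lie in \<open>(0,1)\<close>, as is the case for
  every self-similar set.
\<close>

definition similarity_dimension :: "nat \<Rightarrow> (nat \<Rightarrow> real) \<Rightarrow> real" where
  "similarity_dimension m r = (THE s. (\<Sum>i\<in>{1..m}. r i powr s) = 1)"

text \<open>
  The covering balls may be centred anywhere in the ambient space. The minimum exists for bounded
  \<open>Z\<close> and \<open>r > 0\<close>, the only case in which it is used below.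
\<close>

definition covering_number :: "'a::euclidean_space set \<Rightarrow> real \<Rightarrow> nat" where
  "covering_number Z r =
     (LEAST k. \<exists>C. finite C \<and> card C = k \<and> Z \<subseteq> (\<Union>c\<in>C. cball c r))"

definition assouad_dim :: "'a::euclidean_space set \<Rightarrow> ereal" where
  "assouad_dim X =
     Inf (ereal ` {\<alpha>. \<alpha> \<ge> 0 \<and>
       (\<exists>C>0. \<forall>r R. 0 < r \<longrightarrow> r < R \<longrightarrow>
          (\<forall>x\<in>X. real (covering_number (cball x R \<inter> X) r) \<le> C * (R / r) powr \<alpha>))})"

end

theory Submission
  imports Defs "HOL-Real_Asymp.Real_Asymp"
begin

text \<open>
  The set \<open>K\<close> lies in a Lipschitz image of a part of a homogeneous Cantor set whose dimension is
  barely larger than the Assouad dimension of \<open>K\<close>, and the Lipschitz map can be chosen with a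
  decomposable inverse. Let \<open>\<alpha>\<close> be an admissible exponent in the definition of the Assouad
  dimension, \<open>n\<close> the dimension of the space, and \<open>\<alpha> < \<beta> < n\<close>. Cut a large cube around \<open>K\<close> into
  \<open>q^n\<close> congruent cubes, cut each of these in the same way, and so on. By the choice of \<open>\<alpha>\<close>, a
  cube of any generation that meets \<open>K\<close> has at most \<open>C' q powr \<alpha>\<close> subcubes that meet \<open>K\<close>, where
  \<open>C'\<close> does not depend on \<open>q\<close> (\<open>card_subcells_le\<close>). If \<open>q\<close> is even and large, some integer \<open>m\<close>
  satisfies \<open>C' q powr \<alpha> \<le> m \<le> q powr \<beta>\<close> and \<open>m \<le> (q/2)^n\<close> (\<open>exists_base_and_digit_count\<close>). The
  last inequality leaves room for a set of \<open>m\<close> digit vectors with even entries below \<open>q\<close>. The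
  closure of the set of points with a base \<open>q\<close> expansion in these digits is a homogeneous
  self-similar set \<open>S\<close> with strong separation, because distinct even digits keep the pieces apart
  (\<open>attractor_self_similar\<close>). Its dimension is \<open>log q m \<le> \<beta>\<close>.

  Labelling the subcubes of each cube injectively by digits turns the address of a point of \<open>K\<close>
  into an expansion, which gives a map \<open>g\<close> from \<open>K\<close> to \<open>S\<close> (\<open>coding_by_expansions\<close>). Images under
  \<open>g\<close> that are close have a long common initial segment of digits, so their preimages lie in a
  common small cube; hence the inverse of \<open>g\<close> is Lipschitz. The map \<open>g\<close> itself need not be
  continuous, since neighbouring points may lie in different cubes, but a ball meets at most \<open>3^n\<close>
  cubes of comparable size, so \<open>g\<close> maps it into boundedly many balls of comparable radius. The
  inverse of \<open>g\<close> therefore extends to a Lipschitz map \<open>f\<close> on a compact subset \<open>S'\<close> of \<open>S\<close>, whose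
  inverse is Lipschitz decomposable and whose image contains \<open>K\<close>
  (\<open>lipschitz_decomposable_inverse_of_coding\<close>). The three properties of \<open>D\<close> yield \<open>D K \<le> D (f `
  S') \<le> D S' \<le> D S \<le> \<beta>\<close>, and \<open>\<beta>\<close> can be taken arbitrarily close to \<open>\<alpha>\<close>. For \<open>\<alpha> \<ge> n\<close> the bound \<open>D K
  \<le> n\<close> suffices.
\<close>

section \<open>Lipschitz decomposable inverses from codings\<close>

text \<open>
  Lipschitz decomposability asks for exactly \<open>M\<close> centres; a smaller set of centres is padded with
  repetitions of some point of \<open>Y\<close>.
\<close>

lemma finite_subset_enumerated:
  assumes "finite T" "card T \<le> M" "T \<subseteq> Y" "Y \<noteq> {}"
  obtains y :: "nat \<Rightarrow> 'a" where "\<forall>i\<in>{1..M}. y i \<in> Y" "T \<subseteq> y ` {1..M}"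
proof -
  obtain h where h: "bij_betw h {1..card T} T"
    using ex_bij_betw_nat_finite_1[OF assms(1)] by auto
  obtain t where t: "t \<in> Y"
    using assms(4) by auto
  define y where "y i = (if i \<in> {1..card T} then h i else t)" for i
  have "y i \<in> Y" for i
    using bij_betwE[OF h] assms(3) t by (auto simp: y_def)
  moreover have "T \<subseteq> y ` {1..M}"
  proof
    fix s assume "s \<in> T"
    then obtain i where "i \<in> {1..card T}" "s = h i"
      using h unfolding bij_betw_def by blast
    then show "s \<in> y ` {1..M}"
      using assms(2) by (intro image_eqI[of _ _ i]) (auto simp: y_def)
  qed
  ultimately show ?thesis
    using that by blast
qed

text \<open>
  The inverse of \<open>g\<close> is Lipschitz, so it extends to the closure \<open>S'\<close> of \<open>g ` K\<close>, which is
  compact. A point \<open>s\<close> of \<open>S'\<close> that \<open>f\<close> sends into a ball is a limit of points \<open>g x\<close>, where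
  the points \<open>x = f (g x)\<close> eventually lie in the concentric ball of twice the radius. The closed
  balls that cover the \<open>g\<close>-image of the larger ball thus also cover \<open>s\<close>.
\<close>

lemma lipschitz_decomposable_inverse_of_coding:
  fixes K :: "'a::complete_space set" and g :: "'a \<Rightarrow> 'b::metric_space"
  assumes S: "compact S" "g ` K \<subseteq> S"
    and expanding: "0 \<le> L" "\<And>x y. x \<in> K \<Longrightarrow> y \<in> K \<Longrightarrow> dist x y \<le> L * dist (g x) (g y)"
    and covered: "0 < c" "\<And>y r. 0 < r \<Longrightarrow> \<exists>T\<subseteq>g ` K. finite T \<and> card T \<le> M \<and>
        g ` (cball y r \<inter> K) \<subseteq> (\<Union>t\<in>T. cball t (c * r))"
  obtains S' f where "S' \<subseteq> S" "compact S'" "L-lipschitz_on S' f"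
    "lipschitz_decomposable (f ` S') S' (inverse_relation S' f)" "K \<subseteq> f ` S'"
proof -
  define S' where "S' = closure (g ` K)"
  have S'_S: "S' \<subseteq> S"
    unfolding S'_def using S by (intro closure_minimal compact_imp_closed)
  then have S'_compact: "compact S'"
    using compact_Int_closed[OF S(1), of S'] by (simp add: S'_def Int_absorb1)
  have inj: "inj_on g K"
  proof (rule inj_onI)
    fix x y assume "x \<in> K" "y \<in> K" "g x = g y"
    then show "x = y"
      using expanding(2)[of x y] by simp
  qed
  have "L-lipschitz_on (g ` K) (inv_into K g)"
    using expanding inj by (auto intro!: lipschitz_onI)
  then obtain f where f: "L-lipschitz_on S' f" "\<And>x. x \<in> K \<Longrightarrow> f (g x) = x"
    using lipschitz_extend_closure[of L "g ` K" "inv_into K g"] inj by (auto simp: S'_def)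
  have cont: "continuous_on S' f"
    using f(1) by (rule lipschitz_on_continuous_on)
  have K_sub: "K \<subseteq> f ` S'"
  proof
    fix x assume "x \<in> K"
    then have "g x \<in> S'"
      using closure_subset by (force simp: S'_def)
    then show "x \<in> f ` S'"
      using f(2)[OF \<open>x \<in> K\<close>] by force
  qed
  have cover: "\<exists>y. (\<forall>i\<in>{1..M}. y i \<in> S') \<and> inverse_relation S' f `` (cball y0 r \<inter> f ` S')
      \<subseteq> (\<Union>i\<in>{1..M}. cball (y i) (2 * c * r) \<inter> S')" if y0: "y0 \<in> f ` S'" and r: "0 < r" for y0 r
  proof -
    obtain T where T: "T \<subseteq> g ` K" "finite T" "card T \<le> M"
        "g ` (cball y0 (2 * r) \<inter> K) \<subseteq> (\<Union>t\<in>T. cball t (c * (2 * r)))"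
      using covered(2)[of "2 * r" y0] r by auto
    have "T \<subseteq> S'"
      using T(1) closure_subset unfolding S'_def by blast
    moreover have "S' \<noteq> {}"
      using y0 by auto
    ultimately obtain y :: "nat \<Rightarrow> 'b" where y: "\<forall>i\<in>{1..M}. y i \<in> S'" "T \<subseteq> y ` {1..M}"
      using finite_subset_enumerated[OF T(2,3)] by metis
    \<comment> \<open>A finite union of closed balls is closed, so it suffices to cover points of \<open>g ` K\<close>
      near \<open>s\<close>.\<close>
    have closed: "closed (\<Union>t\<in>T. cball t (c * (2 * r)))"
      using T(2) by (intro closed_UN) auto
    have "s \<in> (\<Union>t\<in>T. cball t (c * (2 * r)))" if s: "s \<in> S'" "f s \<in> cball y0 r" for s
    proof -
      obtain z where z: "\<And>j. z j \<in> g ` K" "z \<longlonglongrightarrow> s"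
        using s(1) unfolding S'_def closure_sequential by blast
      have zS: "z j \<in> S'" for j
        using subsetD[OF closure_subset z(1)] by (simp add: S'_def)
      have "(\<lambda>j. f (z j)) \<longlonglongrightarrow> f s"
        using continuous_on_tendsto_compose[OF cont z(2) s(1)] zS by auto
      moreover have "f s \<in> ball y0 (2 * r)"
        using s(2) r by simp
      ultimately have "eventually (\<lambda>j. f (z j) \<in> ball y0 (2 * r)) sequentially"
        by (rule topological_tendstoD[OF _ open_ball])
      then have "eventually (\<lambda>j. z j \<in> (\<Union>t\<in>T. cball t (c * (2 * r)))) sequentially"
      proof eventually_elim
        case (elim j)
        obtain x where x: "x \<in> K" "z j = g x"
          using z(1) by blast
        then have "x \<in> cball y0 (2 * r) \<inter> K"
          using elim f(2) by auto
        then show ?case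
          using T(4) x(2) by blast
      qed
      then show ?thesis
        by (rule Lim_in_closed_set[OF closed _ sequentially_bot z(2)])
    qed
    moreover have "(\<Union>t\<in>T. cball t (c * (2 * r))) \<subseteq> (\<Union>i\<in>{1..M}. cball (y i) (2 * c * r))"
      using UN_mono[OF y(2) subset_refl, of "\<lambda>t. cball t (c * (2 * r))"]
      by (simp add: mult_ac)
    ultimately have "s \<in> (\<Union>i\<in>{1..M}. cball (y i) (2 * c * r))"
      if "s \<in> S'" "f s \<in> cball y0 r" for s
      using that by (meson subsetD)
    then have "inverse_relation S' f `` (cball y0 r \<inter> f ` S')
        \<subseteq> (\<Union>i\<in>{1..M}. cball (y i) (2 * c * r) \<inter> S')"
      by (auto simp: inverse_relation_def)
    then show ?thesis
      using y(1) by blast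
  qed
  have "lipschitz_decomposable (f ` S') S' (inverse_relation S' f)"
    unfolding lipschitz_decomposable_def
  proof (intro conjI exI[of _ M] exI[of _ "2 * c"] ballI allI impI)
    show "inverse_relation S' f \<subseteq> f ` S' \<times> S'" "Domain (inverse_relation S' f) = f ` S'"
      by (auto simp: inverse_relation_def)
    show "0 < 2 * c"
      using covered(1) by simp
  qed (fact cover)
  with S'_S S'_compact f(1) K_sub show ?thesis
    using that by blast
qed

section \<open>Digit expansions with separated digits\<close>

lemma closure_finite_UN:
  assumes "finite I"
  shows "closure (\<Union>i\<in>I. T i) = (\<Union>i\<in>I. closure (T i))"
  using assms by (induction rule: finite_induct) auto

text \<open>
  Distinct digits differ by at least 2 in some coordinate, whereas any two expansions differ by at
  most 1 in each coordinate, since digit entries lie between 0 and \<open>q - 1\<close>. This leaves a gap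
  of \<open>1 / q\<close> between expansions with distinct first digits.
\<close>

locale separated_digits =
  fixes q :: nat and A :: "(real ^ 'n) set"
  assumes base: "2 \<le> q"
    and finite_digits: "finite A"
    and digits_nonempty: "A \<noteq> {}"
    and digit_range: "v \<in> A \<Longrightarrow> 0 \<le> v $ i \<and> v $ i \<le> real q - 1"
    and digit_gap: "v \<in> A \<Longrightarrow> w \<in> A \<Longrightarrow> v \<noteq> w \<Longrightarrow> \<exists>i. 2 \<le> \<bar>v $ i - w $ i\<bar>"
begin

definition expansion :: "(nat \<Rightarrow> real ^ 'n) \<Rightarrow> real ^ 'n" where
  "expansion \<sigma> = (\<Sum>k. (1 / real q ^ Suc k) *\<^sub>R \<sigma> k)"

definition expansions :: "(real ^ 'n) set" where
  "expansions = {expansion \<sigma> |\<sigma>. range \<sigma> \<subseteq> A}"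

definition digit_map :: "real ^ 'n \<Rightarrow> real ^ 'n \<Rightarrow> real ^ 'n" where
  "digit_map v x = (1 / real q) *\<^sub>R (v + x)"

text \<open>
  Defined as a closure, this set is compact as soon as the expansions are bounded, and the
  self-similarity of the expansions passes to it because the digit maps commute with closures.
\<close>

definition attractor :: "(real ^ 'n) set" where
  "attractor = closure expansions"

lemma q_pos: "0 < real q"
  using base by simp

lemma summable_expansion:
  assumes "range \<sigma> \<subseteq> A"
  shows "summable (\<lambda>k. (1 / real q ^ Suc k) *\<^sub>R \<sigma> k)"
proof -
  obtain B where B: "\<And>v. v \<in> A \<Longrightarrow> norm v \<le> B"
    using finite_imp_bounded[OF finite_digits] by (auto simp: bounded_iff)
  show ?thesis
  proof (rule summable_comparison_test')
    show "summable (\<lambda>k. B * (1 / real q) ^ Suc k)"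
      using base by (intro summable_mult) (simp add: summable_geometric)
    show "norm ((1 / real q ^ Suc k) *\<^sub>R \<sigma> k) \<le> B * (1 / real q) ^ Suc k" for k
    proof -
      have "norm (\<sigma> k) \<le> B"
        using B[of "\<sigma> k"] assms by blast
      then show ?thesis
        by (simp add: power_divide divide_right_mono)
    qed
  qed
qed

lemma expansion_Cons:
  assumes "range \<sigma> \<subseteq> A"
  shows "expansion \<sigma> = digit_map (\<sigma> 0) (expansion (\<sigma> \<circ> Suc))"
proof -
  let ?f = "\<lambda>k. (1 / real q ^ Suc k) *\<^sub>R \<sigma> k"
  let ?g = "\<lambda>k. (1 / real q ^ Suc k) *\<^sub>R (\<sigma> \<circ> Suc) k"
  have g: "summable ?g"
    using assms by (intro summable_expansion) auto
  have "expansion \<sigma> = ?f 0 + (\<Sum>k. ?f (Suc k))"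
    using suminf_split_head[OF summable_expansion[OF assms]] by (simp add: expansion_def)
  also have "(\<Sum>k. ?f (Suc k)) = (\<Sum>k. (1 / real q) *\<^sub>R ?g k)"
    by (simp add: mult.commute)
  also have "\<dots> = (1 / real q) *\<^sub>R expansion (\<sigma> \<circ> Suc)"
    unfolding expansion_def using g by (rule suminf_scaleR_right[symmetric])
  finally show ?thesis
    by (simp add: digit_map_def scaleR_add_right)
qed

lemma expansion_bounds:
  assumes "range \<sigma> \<subseteq> A"
  shows "0 \<le> expansion \<sigma> $ i" "expansion \<sigma> $ i \<le> 1"
proof -
  let ?f = "\<lambda>k. (1 / real q ^ Suc k) *\<^sub>R \<sigma> k"
  let ?g = "\<lambda>k. (real q - 1) / real q * (1 / real q) ^ k"
  have f: "summable (\<lambda>k. ?f k $ i)"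
    by (rule bounded_linear.summable[OF bounded_linear_vec_nth summable_expansion[OF assms]])
  have eq: "expansion \<sigma> $ i = (\<Sum>k. ?f k $ i)"
    unfolding expansion_def
    by (rule bounded_linear.suminf[OF bounded_linear_vec_nth summable_expansion[OF assms]])
  have range: "0 \<le> \<sigma> k $ i" "\<sigma> k $ i \<le> real q - 1" for k
    using digit_range assms by blast+
  show "0 \<le> expansion \<sigma> $ i"
    unfolding eq by (rule suminf_nonneg[OF f]) (simp add: range)
  have "(\<lambda>k. (1 / real q) ^ k) sums (1 / (1 - 1 / real q))"
    using base by (intro geometric_sums) simp
  then have "?g sums ((real q - 1) / real q * (1 / (1 - 1 / real q)))"
    by (rule sums_mult)
  also have "(real q - 1) / real q * (1 / (1 - 1 / real q)) = 1"
    using base by (simp add: field_simps)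
  finally have g: "?g sums 1" .
  have "(\<Sum>k. ?f k $ i) \<le> (\<Sum>k. ?g k)"
  proof (rule suminf_le[OF _ f sums_summable[OF g]])
    show "?f k $ i \<le> ?g k" for k
      using range(2)[of k] q_pos by (simp add: power_divide divide_right_mono)
  qed
  then show "expansion \<sigma> $ i \<le> 1"
    using sums_unique[OF g] eq by simp
qed

lemma expansions_fixed: "expansions = (\<Union>v\<in>A. digit_map v ` expansions)"
proof
  show "expansions \<subseteq> (\<Union>v\<in>A. digit_map v ` expansions)"
  proof
    fix x assume "x \<in> expansions"
    then obtain \<sigma> where \<sigma>: "range \<sigma> \<subseteq> A" "x = expansion \<sigma>"
      by (auto simp: expansions_def)
    have "range (\<sigma> \<circ> Suc) \<subseteq> A"
      using \<sigma>(1) by auto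
    then have "expansion (\<sigma> \<circ> Suc) \<in> expansions"
      unfolding expansions_def by blast
    moreover have "\<sigma> 0 \<in> A"
      using \<sigma>(1) by auto
    ultimately show "x \<in> (\<Union>v\<in>A. digit_map v ` expansions)"
      using expansion_Cons[OF \<sigma>(1)] \<sigma>(2) by blast
  qed
  show "(\<Union>v\<in>A. digit_map v ` expansions) \<subseteq> expansions"
  proof clarify
    fix v x assume v: "v \<in> A" and "x \<in> expansions"
    then obtain \<sigma> where \<sigma>: "range \<sigma> \<subseteq> A" "x = expansion \<sigma>"
      by (auto simp: expansions_def)
    let ?\<tau> = "case_nat v \<sigma>"
    have \<tau>: "range ?\<tau> \<subseteq> A"
      using v range_subsetD[OF \<sigma>(1)] by (auto split: nat.splits)
    have "?\<tau> \<circ> Suc = \<sigma>"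
      by auto
    then have "digit_map v x = expansion ?\<tau>"
      using expansion_Cons[OF \<tau>] \<sigma>(2) by simp
    then show "digit_map v x \<in> expansions"
      using \<tau> by (auto simp: expansions_def)
  qed
qed

lemma attractor_bounds:
  assumes "x \<in> attractor"
  shows "0 \<le> x $ i" "x $ i \<le> 1"
proof -
  have "expansions \<subseteq> cbox (\<chi> i. 0) (\<chi> i. 1)"
    using expansion_bounds by (auto simp: expansions_def mem_box_cart)
  then have "attractor \<subseteq> cbox (\<chi> i. 0) (\<chi> i. 1)"
    unfolding attractor_def by (intro closure_minimal closed_cbox)
  then have "x \<in> cbox (\<chi> i. 0) (\<chi> i. 1)"
    using assms by auto
  then show "0 \<le> x $ i" "x $ i \<le> 1"
    by (simp_all add: mem_box_cart)
qed

lemma expansion_in_attractor: "range \<sigma> \<subseteq> A \<Longrightarrow> expansion \<sigma> \<in> attractor"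
  unfolding attractor_def using closure_subset by (force simp: expansions_def)

lemma compact_attractor: "compact attractor"
proof -
  have "attractor \<subseteq> cbox (\<chi> i. 0) (\<chi> i. 1)"
    using attractor_bounds by (auto simp: mem_box_cart)
  then have "bounded attractor"
    using bounded_cbox bounded_subset by blast
  then show ?thesis
    by (simp add: attractor_def compact_eq_bounded_closed)
qed

lemma attractor_nonempty: "attractor \<noteq> {}"
proof -
  obtain v where "v \<in> A"
    using digits_nonempty by auto
  then have "expansion (\<lambda>_. v) \<in> attractor"
    by (intro expansion_in_attractor) auto
  then show ?thesis
    by auto
qed

lemma digit_map_closure: "digit_map v ` closure T = closure (digit_map v ` T)"
proof -
  have "digit_map v ` U = (*\<^sub>R) (1 / real q) ` (+) v ` U" for U
    by (auto simp: digit_map_def image_image)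
  then show ?thesis
    by (metis closure_scaleR closure_translation)
qed

lemma attractor_fixed: "attractor = (\<Union>v\<in>A. digit_map v ` attractor)"
proof -
  have "attractor = closure (\<Union>v\<in>A. digit_map v ` expansions)"
    using expansions_fixed by (simp add: attractor_def)
  also have "\<dots> = (\<Union>v\<in>A. closure (digit_map v ` expansions))"
    using finite_digits by (rule closure_finite_UN)
  finally show ?thesis
    unfolding digit_map_closure[symmetric] attractor_def[symmetric] .
qed

lemma dist_digit_map: "dist (digit_map v x) (digit_map v y) = (1 / real q) * dist x y"
  by (simp add: digit_map_def dist_norm flip: scaleR_diff_right)

lemma digit_map_separated:
  assumes "v \<in> A" "w \<in> A" "v \<noteq> w" "x \<in> attractor" "y \<in> attractor"
  shows "1 / real q \<le> dist (digit_map v x) (digit_map w y)"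
proof -
  obtain i where "2 \<le> \<bar>v $ i - w $ i\<bar>"
    using digit_gap assms by blast
  moreover have "\<bar>x $ i - y $ i\<bar> \<le> 1"
    using attractor_bounds[OF assms(4), of i] attractor_bounds[OF assms(5), of i] by linarith
  ultimately have "1 \<le> \<bar>(v + x - (w + y)) $ i\<bar>"
    by simp
  also have "\<dots> \<le> norm (v + x - (w + y))"
    by (rule component_le_norm_cart)
  also have "\<dots> = real q * dist (digit_map v x) (digit_map w y)"
    using q_pos by (simp add: digit_map_def dist_norm flip: scaleR_diff_right)
  finally show ?thesis
    using q_pos by (simp add: field_simps)
qed

text \<open>
  Each common leading digit means that the same similarity of ratio \<open>1 / q\<close> was applied to both
  points. So this bound scales from a bound for the diameter of the unit cube, and the lower bound
  \<open>dist_expansion_ge\<close> scales from the gap between pieces with distinct first digits.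
\<close>

lemma dist_expansion_le:
  assumes "range \<sigma> \<subseteq> A" "range \<tau> \<subseteq> A" "\<And>j. j < k \<Longrightarrow> \<sigma> j = \<tau> j"
  shows "dist (expansion \<sigma>) (expansion \<tau>) \<le> real CARD('n) / real q ^ k"
  using assms
proof (induction k arbitrary: \<sigma> \<tau>)
  case 0
  have "dist (expansion \<sigma>) (expansion \<tau>) \<le> (\<Sum>i\<in>UNIV. \<bar>(expansion \<sigma> - expansion \<tau>) $ i\<bar>)"
    unfolding dist_norm by (rule norm_le_l1_cart)
  also have "\<dots> \<le> (\<Sum>i\<in>(UNIV :: 'n set). 1)"
  proof (rule sum_mono)
    show "\<bar>(expansion \<sigma> - expansion \<tau>) $ i\<bar> \<le> 1" for i
      using expansion_bounds[OF 0(1), of i] expansion_bounds[OF 0(2), of i]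
      unfolding vector_minus_component by linarith
  qed
  finally show ?case
    by simp
next
  case (Suc k)
  have "dist (expansion \<sigma>) (expansion \<tau>)
      = (1 / real q) * dist (expansion (\<sigma> \<circ> Suc)) (expansion (\<tau> \<circ> Suc))"
    using expansion_Cons[OF Suc.prems(1)] expansion_Cons[OF Suc.prems(2)] Suc.prems(3)[of 0]
    by (simp add: dist_digit_map)
  also have "\<dots> \<le> (1 / real q) * (real CARD('n) / real q ^ k)"
    using Suc.prems by (intro mult_left_mono Suc.IH) auto
  finally show ?case
    by simp
qed

lemma dist_expansion_ge:
  assumes "range \<sigma> \<subseteq> A" "range \<tau> \<subseteq> A" "\<And>j. j < k \<Longrightarrow> \<sigma> j = \<tau> j" "\<sigma> k \<noteq> \<tau> k"
  shows "1 / real q ^ Suc k \<le> dist (expansion \<sigma>) (expansion \<tau>)"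
  using assms
proof (induction k arbitrary: \<sigma> \<tau>)
  case 0
  have "range (\<sigma> \<circ> Suc) \<subseteq> A" "range (\<tau> \<circ> Suc) \<subseteq> A" "\<sigma> 0 \<in> A" "\<tau> 0 \<in> A"
    using 0 by auto
  then show ?case
    using digit_map_separated[of "\<sigma> 0" "\<tau> 0"] expansion_Cons[OF 0(1)] expansion_Cons[OF 0(2)]
      0(4) by (simp add: expansion_in_attractor)
next
  case (Suc k)
  have "1 / real q ^ Suc (Suc k) = (1 / real q) * (1 / real q ^ Suc k)"
    by simp
  also have "\<dots> \<le> (1 / real q) * dist (expansion (\<sigma> \<circ> Suc)) (expansion (\<tau> \<circ> Suc))"
    using Suc.prems by (intro mult_left_mono Suc.IH) auto
  also have "\<dots> = dist (expansion \<sigma>) (expansion \<tau>)"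
    using expansion_Cons[OF Suc.prems(1)] expansion_Cons[OF Suc.prems(2)] Suc.prems(3)[of 0]
    by (simp add: dist_digit_map)
  finally show ?case .
qed

lemma attractor_self_similar:
  assumes "bij_betw d {1..m} A"
  shows "self_similar_set m (digit_map \<circ> d) (\<lambda>_. 1 / real q) attractor"
    and "strong_separation m (digit_map \<circ> d) attractor"
proof -
  have A: "d ` {1..m} = A" and inj: "inj_on d {1..m}"
    using assms by (auto simp: bij_betw_def)
  have "(\<Union>i\<in>{1..m}. (digit_map \<circ> d) i ` attractor) = (\<Union>v\<in>d ` {1..m}. digit_map v ` attractor)"
    by simp
  also have "\<dots> = attractor"
    unfolding A by (rule attractor_fixed[symmetric])
  finally show "self_similar_set m (digit_map \<circ> d) (\<lambda>_. 1 / real q) attractor"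
    using attractor_nonempty compact_attractor base
    by (simp add: self_similar_set_def contracting_similarity_def dist_digit_map)
  show "strong_separation m (digit_map \<circ> d) attractor"
    unfolding strong_separation_def
  proof (intro ballI impI)
    fix i j assume ij: "i \<in> {1..m}" "j \<in> {1..m}" "i \<noteq> j"
    then have v: "d i \<in> A" "d j \<in> A" "d i \<noteq> d j"
      using A inj inj_onD[OF inj] by blast+
    have "digit_map (d i) x \<noteq> digit_map (d j) y" if "x \<in> attractor" "y \<in> attractor" for x y
      using digit_map_separated[OF v that] q_pos by auto
    then show "(digit_map \<circ> d) i ` attractor \<inter> (digit_map \<circ> d) j ` attractor = {}"
      by auto
  qed
qed

end

lemma similarity_dimension_equal_ratios:
  assumes "1 \<le> m" "1 < q"
  shows "similarity_dimension m (\<lambda>_. 1 / q) = log q (real m)"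
proof -
  have "(\<Sum>i\<in>{1..m}. (1 / q) powr s) = 1 \<longleftrightarrow> s = log q (real m)" for s
  proof -
    have "(\<Sum>i\<in>{1..m}. (1 / q) powr s) = real m * q powr (- s)"
      using assms by (simp add: powr_minus_divide powr_divide)
    also have "\<dots> = 1 \<longleftrightarrow> real m = q powr s"
      using assms by (simp add: powr_minus divide_simps)
    also have "\<dots> \<longleftrightarrow> s = log q (real m)"
      using assms by (auto simp: log_powr_cancel)
    finally show ?thesis .
  qed
  then show ?thesis
    by (simp add: similarity_dimension_def)
qed

text \<open>
  The entries are taken from \<open>0, 2, \<dots>, 2 * h - 2\<close>; the doubling makes distinct digits differ by at
  least 2 and costs only the factor \<open>2 ^ CARD('n)\<close> in the number of available digits.
\<close>

lemma exists_even_digits: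
  assumes "m \<le> h ^ CARD('n)" "1 \<le> h" "1 \<le> m"
  obtains A :: "(real ^ 'n) set" where "card A = m" "separated_digits (2 * h) A"
proof -
  define V :: "('n \<Rightarrow> nat) set" where "V = (\<Pi>\<^sub>E i\<in>UNIV. {..<h})"
  have "card V = h ^ CARD('n)"
    by (simp add: V_def card_PiE)
  then obtain W where W: "W \<subseteq> V" "card W = m" "finite W"
    using assms(1) obtain_subset_with_card_n by metis
  define vec :: "('n \<Rightarrow> nat) \<Rightarrow> real ^ 'n" where "vec u = (\<chi> i. 2 * real (u i))" for u
  have inj: "inj_on vec W"
    by (auto simp: inj_on_def vec_def vec_eq_iff fun_eq_iff)
  have "separated_digits (2 * h) (vec ` W)"
  proof
    show "2 \<le> 2 * h" "finite (vec ` W)"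
      using assms W by auto
    show "vec ` W \<noteq> {}"
      using assms W by auto
    show "0 \<le> v $ i \<and> v $ i \<le> real (2 * h) - 1" if v: "v \<in> vec ` W" for v i
    proof -
      obtain u where u: "u \<in> V" "v = vec u"
        using v W(1) by blast
      then have "u i < h"
        by (auto simp: V_def PiE_def)
      then show ?thesis
        by (simp add: u vec_def)
    qed
    show "\<exists>i. 2 \<le> \<bar>v $ i - w $ i\<bar>" if vw: "v \<in> vec ` W" "w \<in> vec ` W" "v \<noteq> w" for v w
    proof -
      obtain u u' where u: "v = vec u" "w = vec u'"
        using vw by auto
      then obtain i where "u i \<noteq> u' i"
        using vw(3) by (metis ext)
      then have "1 \<le> \<bar>real (u i) - real (u' i)\<bar>"
        by linarith
      then have "2 \<le> \<bar>v $ i - w $ i\<bar>"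
        by (simp add: u vec_def)
      then show ?thesis ..
    qed
  qed
  moreover have "card (vec ` W) = m"
    using W inj by (simp add: card_image)
  ultimately show ?thesis
    using that by blast
qed

section \<open>Grid cells and covering numbers\<close>

definition grid_cell :: "real ^ 'n \<Rightarrow> real \<Rightarrow> real ^ 'n \<Rightarrow> int ^ 'n" where
  "grid_cell a s x = (\<chi> i. \<lfloor>(x $ i - a $ i) / s\<rfloor>)"

lemma dist_le_same_grid_cell:
  fixes x y :: "real ^ 'n"
  assumes "0 < s" "grid_cell a s x = grid_cell a s y"
  shows "dist x y \<le> real CARD('n) * s"
proof -
  have "\<bar>(x - y) $ i\<bar> \<le> s" for i
  proof -
    have "\<lfloor>(x $ i - a $ i) / s\<rfloor> = \<lfloor>(y $ i - a $ i) / s\<rfloor>"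
      using assms(2) by (simp add: grid_cell_def vec_eq_iff)
    then have "\<bar>(x $ i - a $ i) / s - (y $ i - a $ i) / s\<bar> \<le> 1"
      by linarith
    then have "\<bar>(x - y) $ i / s\<bar> \<le> 1"
      by (simp add: diff_divide_distrib)
    then show ?thesis
      using assms(1) by (simp add: field_simps)
  qed
  then have "(\<Sum>i\<in>UNIV. \<bar>(x - y) $ i\<bar>) \<le> (\<Sum>i\<in>(UNIV :: 'n set). s)"
    by (intro sum_mono)
  then show ?thesis
    using norm_le_l1_cart[of "x - y"] by (simp add: dist_norm)
qed

lemma grid_cell_refine:
  assumes "0 < q" "grid_cell a (s / real q) x = grid_cell a (s / real q) y"
  shows "grid_cell a s x = grid_cell a s y"
proof -
  have "grid_cell a s z $ i = grid_cell a (s / real q) z $ i div int q" for z i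
  proof -
    have "(z $ i - a $ i) / s = ((z $ i - a $ i) / (s / real q)) / real_of_int (int q)"
      using assms(1) by simp
    then show ?thesis
      using floor_divide_real_eq_div[of "int q" "(z $ i - a $ i) / (s / real q)"]
      by (simp add: grid_cell_def)
  qed
  then show ?thesis
    using assms(2) by (simp add: vec_eq_iff)
qed

text \<open>
  Moving a coordinate by at most one mesh width changes its floor by at most 1, so each coordinate
  of the cell takes at most three values on the ball.
\<close>

lemma grid_cells_of_cball:
  fixes y :: "real ^ 'n"
  assumes "0 < s" "r \<le> s"
  shows "finite (grid_cell a s ` cball y r)" "card (grid_cell a s ` cball y r) \<le> 3 ^ CARD('n)"
proof -
  define c where "c = grid_cell a s y"
  define V :: "('n \<Rightarrow> int) set" where "V = (\<Pi>\<^sub>E i\<in>UNIV. {c $ i - 1..c $ i + 1})"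
  have V: "finite V" "card V = 3 ^ CARD('n)"
    by (simp_all add: V_def card_PiE finite_PiE)
  have sub: "grid_cell a s ` cball y r \<subseteq> vec_lambda ` V"
  proof clarify
    fix x assume x: "x \<in> cball y r"
    have "grid_cell a s x $ i \<in> {c $ i - 1..c $ i + 1}" for i
    proof -
      have "\<bar>(x - y) $ i\<bar> \<le> s"
        using component_le_norm_cart[of "x - y" i] x assms(2)
        by (simp add: dist_norm norm_minus_commute)
      then have "\<bar>(x - y) $ i / s\<bar> \<le> 1"
        using assms(1) by simp
      moreover have "(x - y) $ i / s = (x $ i - a $ i) / s - (y $ i - a $ i) / s"
        by (simp add: diff_divide_distrib)
      ultimately have "\<bar>(x $ i - a $ i) / s - (y $ i - a $ i) / s\<bar> \<le> 1"
        by (simp only:)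
      then show ?thesis
        unfolding c_def grid_cell_def by simp linarith
    qed
    then have "vec_nth (grid_cell a s x) \<in> V"
      by (auto simp: V_def)
    then show "grid_cell a s x \<in> vec_lambda ` V"
      by (metis image_eqI vec_nth_inverse)
  qed
  show "finite (grid_cell a s ` cball y r)"
    using sub V(1) finite_subset by blast
  have "card (grid_cell a s ` cball y r) \<le> card (vec_lambda ` V)"
    using sub V(1) by (intro card_mono) auto
  also have "\<dots> \<le> 3 ^ CARD('n)"
    using card_image_le[OF V(1)] V(2) by metis
  finally show "card (grid_cell a s ` cball y r) \<le> 3 ^ CARD('n)" .
qed

lemma bounded_in_grid_cell:
  fixes K :: "(real ^ 'n) set"
  assumes "bounded K"
  obtains a s where "0 < s" "\<And>x. x \<in> K \<Longrightarrow> grid_cell a s x = 0"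
proof -
  obtain b where b: "0 < b" "\<And>x. x \<in> K \<Longrightarrow> norm x \<le> b"
    using assms by (auto simp: bounded_pos)
  \<comment> \<open>Mesh \<open>3 * b\<close> instead of \<open>2 * b\<close>, because a cell does not contain its upper faces.\<close>
  have "grid_cell (\<chi> i. - b) (3 * b) x = 0" if "x \<in> K" for x
  proof -
    have "\<lfloor>(x $ i + b) / (3 * b)\<rfloor> = 0" for i
    proof -
      have "\<bar>x $ i\<bar> \<le> b"
        using component_le_norm_cart[of x i] b(2)[OF that] by linarith
      then have "0 \<le> (x $ i + b) / (3 * b)" "(x $ i + b) / (3 * b) < 1"
        using b(1) by (simp_all add: field_simps abs_le_iff)
      then show ?thesis
        by (simp add: floor_eq_iff)
    qed
    then show ?thesis
      by (simp add: grid_cell_def vec_eq_iff)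
  qed
  then show ?thesis
    using b(1) by (intro that[of "3 * b" "\<chi> i. - b"]) simp_all
qed

lemma covering_number_attained:
  fixes Z :: "'a::euclidean_space set"
  assumes "bounded Z" "0 < r"
  obtains C where "finite C" "card C = covering_number Z r" "Z \<subseteq> (\<Union>c\<in>C. cball c r)"
proof -
  have "compact (closure Z)"
    using assms(1) by simp
  then obtain C where C: "finite C" "closure Z \<subseteq> (\<Union>c\<in>C. ball c r)"
    using assms(2) unfolding compact_eq_totally_bounded by blast
  have "Z \<subseteq> (\<Union>c\<in>C. cball c r)"
    by (rule order_trans[OF closure_subset order_trans[OF C(2) UN_mono[OF subset_refl ball_subset_cball]]])
  then have "\<exists>k. \<exists>C. finite C \<and> card C = k \<and> Z \<subseteq> (\<Union>c\<in>C. cball c r)"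
    using C(1) by blast
  from LeastI_ex[OF this] show ?thesis
    using that unfolding covering_number_def by blast
qed

text \<open>
  The part of \<open>K\<close> in one cell of mesh \<open>s\<close> has diameter at most \<open>CARD('n) * s\<close>, so the Assouad
  bound covers it by few balls whose radius is the finer mesh \<open>s / q\<close>. Each of these balls meets
  at most \<open>3 ^ CARD('n)\<close> of the finer cells.
\<close>

lemma card_subcells_le:
  fixes K :: "(real ^ 'n) set"
  assumes assouad: "\<And>r R x. 0 < r \<Longrightarrow> r < R \<Longrightarrow> x \<in> K \<Longrightarrow>
      real (covering_number (cball x R \<inter> K) r) \<le> C * (R / r) powr \<alpha>"
    and C: "0 < C" and q: "2 \<le> q" and s: "0 < s"
  shows "finite (grid_cell a (s / real q) ` {x \<in> K. grid_cell a s x = P}) \<and>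
    real (card (grid_cell a (s / real q) ` {x \<in> K. grid_cell a s x = P}))
      \<le> 3 ^ CARD('n) * (C * (real CARD('n) * real q) powr \<alpha>)"
proof -
  let ?T = "grid_cell a (s / real q) ` {x \<in> K. grid_cell a s x = P}"
  have "finite ?T \<and> real (card ?T) \<le> 3 ^ CARD('n) * (C * (real CARD('n) * real q) powr \<alpha>)"
    if nonempty: "?T \<noteq> {}"
  proof -
    obtain x where x: "x \<in> K" "grid_cell a s x = P"
      using nonempty by auto
    define R where "R = real CARD('n) * s"
    define r where "r = s / real q"
    have r: "0 < r" "r < R" "R / r = real CARD('n) * real q"
    proof -
      show "0 < r" "R / r = real CARD('n) * real q"
        using s q by (simp_all add: r_def R_def)
      have "r < s"
        using s q by (simp add: r_def field_simps)
      also have "s \<le> R"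
        using s by (simp add: R_def Suc_le_eq)
      finally show "r < R" .
    qed
    have "bounded (cball x R \<inter> K)"
      by (simp add: bounded_Int)
    then obtain B where B: "finite B" "card B = covering_number (cball x R \<inter> K) r"
        "cball x R \<inter> K \<subseteq> (\<Union>b\<in>B. cball b r)"
      using r(1) by (rule covering_number_attained)
    have sub: "?T \<subseteq> (\<Union>b\<in>B. grid_cell a r ` cball b r)"
    proof clarify
      fix z assume z: "z \<in> K" "P = grid_cell a s z"
      then have "z \<in> cball x R \<inter> K"
        using dist_le_same_grid_cell[OF s, of a x z] x by (simp add: R_def)
      then obtain b where "b \<in> B" "z \<in> cball b r"
        using B(3) by blast
      then show "grid_cell a (s / real q) z \<in> (\<Union>b\<in>B. grid_cell a r ` cball b r)"
        unfolding r_def[symmetric] by blast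
    qed
    have fin: "finite (\<Union>b\<in>B. grid_cell a r ` cball b r)"
      using B(1) grid_cells_of_cball(1)[OF r(1) order_refl] by auto
    have "card ?T \<le> card (\<Union>b\<in>B. grid_cell a r ` cball b r)"
      using fin sub by (rule card_mono)
    also have "\<dots> \<le> (\<Sum>b\<in>B. card (grid_cell a r ` cball b r))"
      using B(1) by (rule card_UN_le)
    also have "\<dots> \<le> (\<Sum>b\<in>B. 3 ^ CARD('n))"
      by (intro sum_mono grid_cells_of_cball r(1) order_refl)
    finally have "card ?T \<le> 3 ^ CARD('n) * card B"
      by (simp add: mult.commute)
    then have "real (card ?T) \<le> 3 ^ CARD('n) * real (card B)"
      using of_nat_mono by fastforce
    also have "\<dots> \<le> 3 ^ CARD('n) * (C * (real CARD('n) * real q) powr \<alpha>)"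
      using assouad[OF r(1,2) x(1)] B(2) r(3) by (intro mult_left_mono) auto
    finally show ?thesis
      using finite_subset[OF sub fin] by blast
  qed
  then show ?thesis
    using C by (cases "?T = {}") (auto simp del: image_is_empty)
qed

section \<open>Coding a set of small Assouad dimension\<close>

text \<open>
  Since \<open>\<alpha> < \<beta> < N\<close>, the terms \<open>C * q powr \<alpha>\<close>, \<open>q powr \<beta>\<close> and \<open>(q / 2) ^ N\<close> grow at
  strictly increasing rates. The summand 1 in the intermediate estimates pays for rounding
  \<open>q powr \<beta>\<close> down to an integer.
\<close>

lemma exists_base_and_digit_count:
  fixes \<alpha> \<beta> C :: real and N :: nat
  assumes "0 \<le> \<alpha>" "\<alpha> < \<beta>" "\<beta> < real N" "0 < C"
  obtains h m :: nat where "1 \<le> h" "1 \<le> m" "m \<le> h ^ N"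
    "C * real (2 * h) powr \<alpha> \<le> real m" "real m \<le> real (2 * h) powr \<beta>"
proof -
  define \<gamma> where "\<gamma> = \<beta> - \<alpha>"
  have "0 < \<beta>" "0 < \<gamma>"
    using assms by (auto simp: \<gamma>_def)
  have "eventually (\<lambda>h::nat. C + 1 \<le> (2 * real h) powr \<gamma>) at_top"
    using \<open>0 < \<gamma>\<close> by real_asymp
  moreover have "eventually (\<lambda>h::nat. (2 * real h) powr \<beta> \<le> real h powr real N) at_top"
    using assms(3) \<open>0 < \<beta>\<close> by real_asymp
  ultimately have "eventually (\<lambda>h::nat. C + 1 \<le> (2 * real h) powr \<gamma> \<and>
      (2 * real h) powr \<beta> \<le> real h powr real N \<and> 1 \<le> h) at_top"
    by (intro eventually_conj eventually_ge_at_top)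
  then obtain h :: nat where h': "C + 1 \<le> (2 * real h) powr \<gamma>"
      and h: "(2 * real h) powr \<beta> \<le> real h powr real N" "1 \<le> h"
    using eventually_happens'[OF sequentially_bot] by blast
  have "1 \<le> (2 * real h) powr \<alpha>"
    using h(2) assms(1) by (intro ge_one_powr_ge_zero) auto
  then have "C * (2 * real h) powr \<alpha> + 1 \<le> (2 * real h) powr \<alpha> * (C + 1)"
    by (simp add: algebra_simps)
  also have "\<dots> \<le> (2 * real h) powr \<alpha> * (2 * real h) powr \<gamma>"
    using h' by (intro mult_left_mono) auto
  also have "\<dots> = (2 * real h) powr \<beta>"
    by (simp add: \<gamma>_def flip: powr_add)
  finally have big: "C * (2 * real h) powr \<alpha> + 1 \<le> (2 * real h) powr \<beta>" .
  define m where "m = nat \<lfloor>(2 * real h) powr \<beta>\<rfloor>"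
  have m: "real m \<le> (2 * real h) powr \<beta>" "(2 * real h) powr \<beta> < real m + 1"
    unfolding m_def by (simp_all add: of_nat_floor)
  have "0 < C * (2 * real h) powr \<alpha>"
    using h(2) assms(4) by simp
  then have "0 < real m"
    using big m(2) by linarith
  moreover have "real m \<le> real (h ^ N)"
    using order_trans[OF m(1) h(1)] h(2) by (simp add: powr_realpow)
  ultimately show ?thesis
    using big h m by (intro that[of h m]) auto
qed

text \<open>
  The \<open>k\<close>-th digit of \<open>g x\<close> names the subcell in which \<open>x\<close> lies among the children of its cell of
  generation \<open>k\<close>. As labels are injective on the children of a cell, two points have their first
  \<open>k\<close> digits in common exactly when they lie in the same cell of generation \<open>k\<close>. Both metric
  properties of \<open>g\<close> are translations of this fact.
\<close>

lemma (in separated_digits) coding_by_expansions: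
  fixes K :: "(real ^ 'n) set"
  assumes K: "bounded K"
    and assouad: "\<And>r R x. 0 < r \<Longrightarrow> r < R \<Longrightarrow> x \<in> K \<Longrightarrow>
      real (covering_number (cball x R \<inter> K) r) \<le> C * (R / r) powr \<alpha>"
    and C: "0 < C"
    and many_digits: "3 ^ CARD('n) * (C * (real CARD('n) * real q) powr \<alpha>) \<le> real (card A)"
  obtains g :: "real ^ 'n \<Rightarrow> real ^ 'n" and L c :: real where "g ` K \<subseteq> attractor" "0 \<le> L" "0 < c"
    "\<And>x y. x \<in> K \<Longrightarrow> y \<in> K \<Longrightarrow> dist x y \<le> L * dist (g x) (g y)"
    "\<And>y r. 0 < r \<Longrightarrow> \<exists>T\<subseteq>g ` K. finite T \<and> card T \<le> 3 ^ CARD('n) \<and>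
      g ` (cball y r \<inter> K) \<subseteq> (\<Union>t\<in>T. cball t (c * r))"
proof -
  obtain a s\<^sub>0 where s\<^sub>0: "0 < s\<^sub>0" "\<And>x. x \<in> K \<Longrightarrow> grid_cell a s\<^sub>0 x = 0"
    using bounded_in_grid_cell[OF K] by metis
  define s where "s k = s\<^sub>0 / real q ^ k" for k
  define cell where "cell k = grid_cell a (s k)" for k
  define children where "children k P = cell (Suc k) ` {x \<in> K. cell k x = P}" for k P
  have s_pos: "0 < s k" for k
    using s\<^sub>0(1) q_pos by (simp add: s_def)
  have s_Suc: "s (Suc k) = s k / real q" for k
    by (simp add: s_def)
  have q1: "1 < real q"
    using base by simp
  have children: "finite (children k P) \<and> card (children k P) \<le> card A" for k P
    using card_subcells_le[OF assouad C base s_pos, of a k P] many_digits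
    unfolding children_def cell_def s_Suc by linarith
  have "\<exists>l. l ` children k P \<subseteq> A \<and> inj_on l (children k P)" for k P
    using card_le_inj[of "children k P" A] children finite_digits by blast
  then obtain label where label: "\<And>k P. label k P ` children k P \<subseteq> A"
      "\<And>k P. inj_on (label k P) (children k P)"
    by metis
  define digit where "digit x k = label k (cell k x) (cell (Suc k) x)" for x k
  define g where "g x = expansion (digit x)" for x
  have in_children: "cell (Suc k) x \<in> children k (cell k x)" if "x \<in> K" for x k
    using that by (auto simp: children_def)
  have digit_A: "range (digit x) \<subseteq> A" if "x \<in> K" for x
    using label(1) in_children[OF that] unfolding digit_def by blast
  have cell_eq: "cell k x = cell k y"
    if "x \<in> K" "y \<in> K" "\<And>j. j < k \<Longrightarrow> digit x j = digit y j" for x y k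
    using that
  proof (induction k)
    case 0
    then show ?case
      using s\<^sub>0(2) by (simp add: cell_def s_def)
  next
    case (Suc k)
    then have "cell k x = cell k y"
      by simp
    moreover have "label k (cell k x) (cell (Suc k) x) = label k (cell k y) (cell (Suc k) y)"
      using Suc.prems(3)[of k] by (simp add: digit_def)
    ultimately show ?case
      using inj_onD[OF label(2)] in_children Suc.prems(1,2) by metis
  qed
  have cell_coarser: "cell j x = cell j y" if "cell k x = cell k y" "j \<le> k" for x y j k
    using that(2,1)
  proof (induction rule: inc_induct)
    case (step i)
    then have "grid_cell a (s i / real q) x = grid_cell a (s i / real q) y"
      by (simp add: cell_def s_Suc)
    then show ?case
      using grid_cell_refine[of q] q_pos by (simp add: cell_def)
  qed
  have digit_eq: "digit x j = digit y j" if "cell k x = cell k y" "j < k" for x y j k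
    using cell_coarser[OF that(1), of j] cell_coarser[OF that(1), of "Suc j"] that(2)
    by (simp add: digit_def)
  have cell_dist: "dist x y \<le> real CARD('n) * s k" if "cell k x = cell k y" for x y k
    using dist_le_same_grid_cell[OF s_pos] that by (simp add: cell_def)
  have expanding: "dist x y \<le> (real CARD('n) * s\<^sub>0 * real q) * dist (g x) (g y)"
    if xy: "x \<in> K" "y \<in> K" for x y
  proof (cases "\<forall>k. digit x k = digit y k")
    case True
    then have le: "dist x y \<le> (real CARD('n) * s\<^sub>0) / real q ^ k" for k
      using cell_dist[OF cell_eq[OF xy]] by (simp add: s_def)
    have "(\<lambda>k. (real CARD('n) * s\<^sub>0) / real q ^ k) \<longlonglongrightarrow> 0"
      using q1 by (rule LIMSEQ_divide_realpow_zero)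
    then have "dist x y \<le> 0"
      using le by (intro LIMSEQ_le_const) auto
    then show ?thesis
      by simp
  next
    case False
    define k where "k = (LEAST k. digit x k \<noteq> digit y k)"
    have k: "digit x k \<noteq> digit y k"
      using False LeastI_ex[of "\<lambda>k. digit x k \<noteq> digit y k"] by (auto simp: k_def)
    have less: "digit x j = digit y j" if "j < k" for j
      using not_less_Least[of j] that by (auto simp: k_def)
    have "dist x y \<le> real CARD('n) * s k"
      using cell_dist[OF cell_eq[OF xy less]] .
    also have "\<dots> = (real CARD('n) * s\<^sub>0 * real q) * (1 / real q ^ Suc k)"
      using q_pos by (simp add: s_def)
    also have "\<dots> \<le> (real CARD('n) * s\<^sub>0 * real q) * dist (g x) (g y)"
      unfolding g_def using s\<^sub>0(1) xy less k
      by (intro mult_left_mono dist_expansion_ge digit_A) auto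
    finally show ?thesis .
  qed
  have covered: "\<exists>T\<subseteq>g ` K. finite T \<and> card T \<le> 3 ^ CARD('n) \<and>
      g ` (cball y r \<inter> K) \<subseteq> (\<Union>t\<in>T. cball t (real CARD('n) * real q / s\<^sub>0 * r))"
    if r: "0 < r" for y r
  proof -
    have "s \<longlonglongrightarrow> 0"
      unfolding s_def using q1 by (rule LIMSEQ_divide_realpow_zero)
    then have "eventually (\<lambda>k. s k < r) sequentially"
      using r by (rule order_tendstoD)
    then obtain n where n: "s n < r"
      using eventually_happens'[OF sequentially_bot] by blast
    \<comment> \<open>The generation \<open>k\<close> whose mesh is just above \<open>r\<close>. If \<open>r\<close> exceeds the mesh of
      generation 0, then \<open>k = 0\<close>; there all of \<open>K\<close> lies in a single cell.\<close>
    obtain k where k: "r \<le> s k \<or> k = 0" "s (Suc k) < r"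
    proof (cases "s 0 < r")
      case True
      have "s (Suc 0) \<le> s 0"
        using q1 s_pos[of 0] by (simp add: s_Suc field_simps)
      then show ?thesis
        using True by (intro that[of 0]) auto
    next
      case False
      then obtain k where "\<forall>i\<le>k. \<not> s i < r" "s (Suc k) < r"
        using ex_least_nat_less[of "\<lambda>k. s k < r" n] n by blast
      then show ?thesis
        by (intro that[of k]) (auto simp: not_less)
    qed
    define Q where "Q = cell k ` (cball y r \<inter> K)"
    have Q: "finite Q \<and> card Q \<le> 3 ^ CARD('n)"
      using k(1)
    proof
      assume "r \<le> s k"
      then have fin: "finite (cell k ` cball y r)" and le: "card (cell k ` cball y r) \<le> 3 ^ CARD('n)"
        using grid_cells_of_cball[OF s_pos] by (auto simp: cell_def)
      have sub: "Q \<subseteq> cell k ` cball y r"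
        by (auto simp: Q_def)
      show ?thesis
        using finite_subset[OF sub fin] order_trans[OF card_mono[OF fin sub] le] ..
    next
      assume "k = 0"
      then have "Q \<subseteq> {0}"
        using s\<^sub>0(2) by (auto simp: Q_def cell_def s_def)
      then have "finite Q" "card Q \<le> 1"
        using finite_subset card_mono[of "{0}" Q] by auto
      moreover have "(1::nat) \<le> 3 ^ CARD('n)"
        by simp
      ultimately show ?thesis
        by linarith
    qed
    define rep where "rep = inv_into (cball y r \<inter> K) (cell k)"
    have rep: "rep P \<in> cball y r \<inter> K" "cell k (rep P) = P" if "P \<in> Q" for P
      using that unfolding rep_def Q_def by (rule inv_into_into, rule f_inv_into_f)
    define T where "T = (g \<circ> rep) ` Q"
    have "finite T"
      using Q by (simp add: T_def)
    moreover have "card T \<le> 3 ^ CARD('n)"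
      unfolding T_def using Q order_trans[OF card_image_le] by blast
    moreover have "T \<subseteq> g ` K"
      using rep(1) by (auto simp: T_def)
    moreover have "g ` (cball y r \<inter> K) \<subseteq> (\<Union>t\<in>T. cball t (real CARD('n) * real q / s\<^sub>0 * r))"
    proof
      fix z assume "z \<in> g ` (cball y r \<inter> K)"
      then obtain x where x: "x \<in> cball y r \<inter> K" "z = g x"
        by blast
      let ?x' = "rep (cell k x)"
      have cell_Q: "cell k x \<in> Q"
        using x(1) by (auto simp: Q_def)
      have "dist (g ?x') (g x) \<le> real CARD('n) / real q ^ k"
        unfolding g_def using x(1) rep[OF cell_Q] digit_eq[OF rep(2)[OF cell_Q]]
        by (intro dist_expansion_le digit_A) auto
      also have "\<dots> = real CARD('n) * real q / s\<^sub>0 * s (Suc k)"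
        using s\<^sub>0(1) q_pos by (simp add: s_def)
      also have "\<dots> \<le> real CARD('n) * real q / s\<^sub>0 * r"
        using k(2) s\<^sub>0(1) by (intro mult_left_mono) auto
      finally show "z \<in> (\<Union>t\<in>T. cball t (real CARD('n) * real q / s\<^sub>0 * r))"
        using cell_Q x(2) unfolding T_def by auto
    qed
    ultimately show ?thesis
      by blast
  qed
  show ?thesis
  proof (rule that)
    show "g ` K \<subseteq> attractor"
      using digit_A expansion_in_attractor by (auto simp: g_def)
    show "0 \<le> real CARD('n) * s\<^sub>0 * real q" "0 < real CARD('n) * real q / s\<^sub>0"
      using s\<^sub>0(1) q_pos by simp_all
  qed (use expanding covered in blast)+
qed

section \<open>Upper bound by the Assouad dimension\<close>

theorem theorem5p14:
  fixes F :: "(real ^ 'n) set set" and D :: "(real ^ 'n) set \<Rightarrow> real"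
  assumes contains_compact: "\<And>K. compact K \<Longrightarrow> K \<in> F"
    and range: "\<And>A. A \<in> F \<Longrightarrow> 0 \<le> D A \<and> D A \<le> real CARD('n)"
    and lipschitz: "\<And>K (f :: real ^ 'n \<Rightarrow> real ^ 'n).
          compact K \<Longrightarrow> (\<exists>L. L-lipschitz_on K f) \<Longrightarrow>
          lipschitz_decomposable (f ` K) K (inverse_relation K f) \<Longrightarrow>
          D (f ` K) \<le> D K"
    and monotone: "\<And>A B. A \<in> F \<Longrightarrow> B \<in> F \<Longrightarrow> A \<subseteq> B \<Longrightarrow> D A \<le> D B"
    and self_similar: "\<And>S m (f :: nat \<Rightarrow> real ^ 'n \<Rightarrow> real ^ 'n) r.
          self_similar_set m f r S \<Longrightarrow> homogeneous m r \<Longrightarrow> strong_separation m f S \<Longrightarrow>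
          D S = similarity_dimension m r"
    and K: "K \<in> F" "bounded K"
  shows "ereal (D K) \<le> assouad_dim K"
  unfolding assouad_dim_def
proof (rule Inf_greatest, clarify)
  fix \<alpha> C :: real
  assume \<alpha>: "0 \<le> \<alpha>" and C: "0 < C"
    and "\<forall>r R. 0 < r \<longrightarrow> r < R \<longrightarrow>
      (\<forall>x\<in>K. real (covering_number (cball x R \<inter> K) r) \<le> C * (R / r) powr \<alpha>)"
  then have assouad: "\<And>r R x. 0 < r \<Longrightarrow> r < R \<Longrightarrow> x \<in> K \<Longrightarrow>
      real (covering_number (cball x R \<inter> K) r) \<le> C * (R / r) powr \<alpha>"
    by blast
  have D_le: "D K \<le> \<beta>" if \<beta>: "\<alpha> < \<beta>" "\<beta> < real CARD('n)" for \<beta>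
  proof -
    \<comment> \<open>The bound for the number of subcells is \<open>C' * q powr \<alpha>\<close>.\<close>
    define C' where "C' = 3 ^ CARD('n) * (C * real CARD('n) powr \<alpha>)"
    have "0 < C'"
      using C by (simp add: C'_def)
    then obtain h m :: nat where hm: "1 \<le> h" "1 \<le> m" "m \<le> h ^ CARD('n)"
        "C' * real (2 * h) powr \<alpha> \<le> real m" "real m \<le> real (2 * h) powr \<beta>"
      using exists_base_and_digit_count[OF \<alpha> \<beta>] by metis
    obtain A :: "(real ^ 'n) set" where A: "card A = m" "separated_digits (2 * h) A"
      using exists_even_digits[OF hm(3,1,2)] by blast
    interpret separated_digits "2 * h" A
      by (fact A(2))
    have "3 ^ CARD('n) * (C * (real CARD('n) * real (2 * h)) powr \<alpha>) \<le> real (card A)"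
      using hm(4) A(1) by (simp add: C'_def powr_mult mult_ac)
    then obtain g :: "real ^ 'n \<Rightarrow> real ^ 'n" and L c :: real
      where g: "g ` K \<subseteq> attractor" "0 \<le> L" "0 < c"
        "\<And>x y. x \<in> K \<Longrightarrow> y \<in> K \<Longrightarrow> dist x y \<le> L * dist (g x) (g y)"
        "\<And>y r. 0 < r \<Longrightarrow> \<exists>T\<subseteq>g ` K. finite T \<and> card T \<le> 3 ^ CARD('n) \<and>
          g ` (cball y r \<inter> K) \<subseteq> (\<Union>t\<in>T. cball t (c * r))"
      using coding_by_expansions[OF K(2) assouad C] by blast
    obtain S' f where S': "S' \<subseteq> attractor" "compact S'" "L-lipschitz_on S' f"
        "lipschitz_decomposable (f ` S') S' (inverse_relation S' f)" "K \<subseteq> f ` S'"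
      using lipschitz_decomposable_inverse_of_coding[OF compact_attractor g(1,2,4,3,5)] by blast
    have "compact (f ` S')"
      using S'(2,3) compact_continuous_image lipschitz_on_continuous_on by blast
    then have "D K \<le> D (f ` S')"
      using S'(5) K(1) contains_compact monotone by blast
    also have "\<dots> \<le> D S'"
      using lipschitz S'(2-4) by blast
    also have "\<dots> \<le> D attractor"
      using S'(1,2) compact_attractor contains_compact monotone by blast
    also have "\<dots> = log (real (2 * h)) (real m)"
    proof -
      obtain d where d: "bij_betw d {1..m} A"
        using ex_bij_betw_nat_finite_1[OF finite_digits] A(1) by blast
      have "D attractor = similarity_dimension m (\<lambda>_. 1 / real (2 * h))"
        using attractor_self_similar[OF d] by (intro self_similar) (auto simp: homogeneous_def)
      then show ?thesis
        using similarity_dimension_equal_ratios[OF hm(2), of "real (2 * h)"] hm(1) by simp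
    qed
    also have "\<dots> \<le> \<beta>"
      using hm(1,2,5) by (simp add: log_le_iff)
    finally show ?thesis .
  qed
  have "D K \<le> \<alpha>"
  proof (cases "\<alpha> < real CARD('n)")
    case True
    then show ?thesis
      using D_le by (rule dense_ge_bounded)
  next
    case False
    then show ?thesis
      using range[OF K(1)] by linarith
  qed
  then show "ereal (D K) \<le> ereal \<alpha>"
    by simp
qed

end
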